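(* Proof System S3VML–II is sound and strongly complete, under Semantics II, with respect to the class of all three-valued Kripke models–II. That is, for any set $\Gamma$ of formulae and any formula $A$ of the three-valued modal language, $$\Gamma\vdash_{\mathrm{II}} A\iff\Gamma\vDash_{\mathrm{II}} A,$$ where $\vDash_{\mathrm{II}}$ is consequence over all three-valued pointed Kripke models–II.
   Context: Language. Fix a non-empty countable set $\mathbf{P}$ of propositional letters. Formulae are generated by $A::=p\mid\neg A\mid A\land A\mid A\lor A\mid\Box A$ with $p\in\mathbf{P}$. All of $\neg,\land,\lor,\Box$ are primitive symbols. Models. A three-valued Kripke model is a triple $(S,R,V)$ where $S$ is a non-empty set of possible worlds, $R\subseteq S\times S$ is a binary relation, and $V:S\times\mathbf{P}\to\{T,U,F\}$. A three-valued Kripke model–II is a three-valued Kripke model such that for any $s\in S$ and $p\in\mathbf{P}$, if $V(s,p)=U$ then $V(t,p)=U$ for all $t\in S$ with $tRs$. A pointed model $\mathfrak{M},s$ is a model together with a world $s\in S$. Semantics II. Given a three-valued Kripke model–II $\mathfrak{M}$, the value $\mathrm{Val}(s,A)\in\{T,U,F\}$ is defined recursively as follows. - $\mathrm{Val}(s,p)=V(s,p)$. - $\mathrm{Val}(s,\neg A)$ is $F,U,T$ when $\mathrm{Val}(s,A)$ is $T,U,F$ respectively. - (Weak Kleene) $\mathrm{Val}(s,A\land B)=\mathrm{Val}(s,A\lor B)=U$ if $\mathrm{Val}(s,A)=U$ or $\mathrm{Val}(s,B)=U$. If both values are in $\{T,F\}$, then $\mathrm{Val}(s,A\land B)$ and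 $\mathrm{Val}(s,A\lor B)$ are given by classical conjunction and disjunction. - $\mathrm{Val}(s,\Box A)=T$ if $\mathrm{Val}(s,A)\neq U$ and $\mathrm{Val}(t,A)=T$ for all $t$ with $sRt$; $=U$ if $\mathrm{Val}(s,A)=U$; $=F$ otherwise. Write $\mathfrak{M},s\vDash_{\mathrm{II}} A$ iff $\mathrm{Val}(s,A)=T$. For a set $\Gamma$ of formulae, $\Gamma\vDash_{\mathrm{II}} A$ means: for every pointed three-valued Kripke model–II $\mathfrak{M},s$, if $\mathfrak{M},s\vDash_{\mathrm{II}} B$ for all $B\in\Gamma$, then $\mathfrak{M},s\vDash_{\mathrm{II}} A$. Proof System S3VML–II. $\Gamma\vdash_{\mathrm{II}} A$ (for $\Gamma$ a possibly infinite set of formulae, $A$ a formula) means that $A$ is derivable by a (finite) natural deduction from assumptions in $\Gamma$ using the rules below. That is, $\vdash_{\mathrm{II}}$ is the least relation such that $\Gamma\vdash_{\mathrm{II}} A$ whenever $A\in\Gamma$, which is closed under weakening of the premise set and composition of derivations (if $\Delta\vdash_{\mathrm{II}} B$ for every $B\in\Gamma$ and $\Gamma\vdash_{\mathrm{II}} A$, then $\Delta\vdash_{\mathrm{II}} A$), and which is closed under the following rules, for all formulae $A,B,C$. Here "$X_1,\dots,X_n\,/\,Y$" means: from derivations of $X_1,\dots,X_n$ from $\Gamma$, obtain a derivation of $Y$ from $\Gamma$. - (EFQ) $A,\ \neg A\,/\,B$. - ($\neg\neg I$) $A\,/\,\neg\neg A$; ($\neg\neg E$) $\neg\neg A\,/\,A$.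 - ($\lor I_1$) $\neg A\land B\,/\,A\lor B$; ($\lor I_2$) $A\land\neg B\,/\,A\lor B$; ($\lor I_3$) $A\land B\,/\,A\lor B$. - ($\lor E$) if $\Gamma\vdash_{\mathrm{II}} A\lor B$, $\Gamma\cup\{A\land B\}\vdash_{\mathrm{II}} C$, $\Gamma\cup\{A\land\neg B\}\vdash_{\mathrm{II}} C$ and $\Gamma\cup\{\neg A\land B\}\vdash_{\mathrm{II}} C$, then $\Gamma\vdash_{\mathrm{II}} C$. - ($\land I$) $A,\ B\,/\,A\land B$; ($\land E_1$) $A\land B\,/\,A$; ($\land E_2$) $A\land B\,/\,B$. - ($\Box I_1$) from $\Gamma\vdash_{\mathrm{II}} A$, deduce $\{A\lor\neg A\}\cup\{\Box B\mid B\in\Gamma\}\vdash_{\mathrm{II}}\Box A$. - ($\Box I_2$) $A\lor\neg A\,/\,\Box(A\lor\neg A)$. - ($\neg\lor I$) $\neg A\land\neg B\,/\,\neg(A\lor B)$; ($\neg\lor E$) $\neg(A\lor B)\,/\,\neg A\land\neg B$. - ($\neg\land I$) $\neg A\lor\neg B\,/\,\neg(A\land B)$; ($\neg\land E$) $\neg(A\land B)\,/\,\neg A\lor\neg B$. - ($\neg\Box I$) $A\lor\neg A\,/\,\Box A\lor\neg\Box A$; ($\neg\Box E$) $\Box A\lor\neg\Box A\,/\,A\lor\neg A$. *)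

theory Defs
  imports Main "HOL-Library.Countable"
begin

datatype 'p fm =
    Atom 'p
  | Neg "'p fm"  ("\<^bold>\<not> _" [75] 75)
  | Conj "'p fm" "'p fm"  (infixr "\<^bold>\<and>" 65)
  | Disj "'p fm" "'p fm"  (infixr "\<^bold>\<or>" 60)
  | Box "'p fm"  ("\<^bold>\<box> _" [75] 75)

datatype tv = TT | UU | FF

text \<open>The set of worlds is an explicit carrier inside the type \<open>'w\<close>; values of \<open>valuation\<close> at points
  outside the carrier are irrelevant.\<close>

record ('w, 'p) kripke =
  worlds :: "'w set"
  acc :: "('w \<times> 'w) set"
  valuation :: "'w \<Rightarrow> 'p \<Rightarrow> tv"

definition kripke_model :: "('w, 'p) kripke \<Rightarrow> bool" where
  "kripke_model M \<longleftrightarrow> worlds M \<noteq> {} \<and> acc M \<subseteq> worlds M \<times> worlds M"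

text \<open>Being undefined propagates to predecessors: \<open>t\<close> ranges over the worlds that see \<open>s\<close>.\<close>

definition kripke_model_II :: "('w, 'p) kripke \<Rightarrow> bool" where
  "kripke_model_II M \<longleftrightarrow> kripke_model M \<and>
     (\<forall>s\<in>worlds M. \<forall>p. valuation M s p = UU \<longrightarrow>
        (\<forall>t\<in>worlds M. (t, s) \<in> acc M \<longrightarrow> valuation M t p = UU))"

fun neg_tv :: "tv \<Rightarrow> tv" where
  "neg_tv TT = FF"
| "neg_tv UU = UU"
| "neg_tv FF = TT"

definition conj_tv :: "tv \<Rightarrow> tv \<Rightarrow> tv" where
  "conj_tv x y = (if x = UU \<or> y = UU then UU else if x = TT \<and> y = TT then TT else FF)"

definition disj_tv :: "tv \<Rightarrow> tv \<Rightarrow> tv" where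
  "disj_tv x y = (if x = UU \<or> y = UU then UU else if x = TT \<or> y = TT then TT else FF)"

primrec Val :: "('w, 'p) kripke \<Rightarrow> 'w \<Rightarrow> 'p fm \<Rightarrow> tv" where
  "Val M s (Atom p) = valuation M s p"
| "Val M s (\<^bold>\<not> A) = neg_tv (Val M s A)"
| "Val M s (A \<^bold>\<and> B) = conj_tv (Val M s A) (Val M s B)"
| "Val M s (A \<^bold>\<or> B) = disj_tv (Val M s A) (Val M s B)"
| "Val M s (\<^bold>\<box> A) =
     (if Val M s A \<noteq> UU \<and> (\<forall>t\<in>worlds M. (s, t) \<in> acc M \<longrightarrow> Val M t A = TT) then TT
      else if Val M s A = UU then UU
      else FF)"

definition sat_II :: "('w, 'p) kripke \<Rightarrow> 'w \<Rightarrow> 'p fm \<Rightarrow> bool"  ("_, _ \<Turnstile>\<^sub>I\<^sub>I _" [51, 51, 51] 50) where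
  "(M, s \<Turnstile>\<^sub>I\<^sub>I A) \<longleftrightarrow> Val M s A = TT"

text \<open>Consequence over all pointed models whose worlds are drawn from the type \<open>'w\<close>. HOL cannot
  quantify over types inside a formula, so the type of worlds is a parameter: soundness is claimed for
  every choice of it, and for completeness \<open>'p fm set\<close> is large enough, because the worlds of the
  canonical model are sets of formulae.\<close>

definition consequence_II :: "'w itself \<Rightarrow> 'p fm set \<Rightarrow> 'p fm \<Rightarrow> bool" where
  "consequence_II (W :: 'w itself) \<Gamma> A \<longleftrightarrow>
     (\<forall>(M :: ('w, 'p) kripke) s. kripke_model_II M \<and> s \<in> worlds M \<longrightarrow>
        (\<forall>B\<in>\<Gamma>. M, s \<Turnstile>\<^sub>I\<^sub>I B) \<longrightarrow> (M, s \<Turnstile>\<^sub>I\<^sub>I A))"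

inductive deriv_II :: "'p fm set \<Rightarrow> 'p fm \<Rightarrow> bool"  (infix "\<turnstile>\<^sub>I\<^sub>I" 50) where
  Assm: "A \<in> \<Gamma> \<Longrightarrow> \<Gamma> \<turnstile>\<^sub>I\<^sub>I A"
| Weaken: "\<Gamma> \<turnstile>\<^sub>I\<^sub>I A \<Longrightarrow> \<Gamma> \<subseteq> \<Delta> \<Longrightarrow> \<Delta> \<turnstile>\<^sub>I\<^sub>I A"
| Comp: "(\<And>B. B \<in> \<Gamma> \<Longrightarrow> \<Delta> \<turnstile>\<^sub>I\<^sub>I B) \<Longrightarrow> \<Gamma> \<turnstile>\<^sub>I\<^sub>I A \<Longrightarrow> \<Delta> \<turnstile>\<^sub>I\<^sub>I A"
| EFQ: "\<Gamma> \<turnstile>\<^sub>I\<^sub>I A \<Longrightarrow> \<Gamma> \<turnstile>\<^sub>I\<^sub>I \<^bold>\<not> A \<Longrightarrow> \<Gamma> \<turnstile>\<^sub>I\<^sub>I B"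
| NegNegI: "\<Gamma> \<turnstile>\<^sub>I\<^sub>I A \<Longrightarrow> \<Gamma> \<turnstile>\<^sub>I\<^sub>I \<^bold>\<not> \<^bold>\<not> A"
| NegNegE: "\<Gamma> \<turnstile>\<^sub>I\<^sub>I \<^bold>\<not> \<^bold>\<not> A \<Longrightarrow> \<Gamma> \<turnstile>\<^sub>I\<^sub>I A"
| DisjI1: "\<Gamma> \<turnstile>\<^sub>I\<^sub>I \<^bold>\<not> A \<^bold>\<and> B \<Longrightarrow> \<Gamma> \<turnstile>\<^sub>I\<^sub>I A \<^bold>\<or> B"
| DisjI2: "\<Gamma> \<turnstile>\<^sub>I\<^sub>I A \<^bold>\<and> \<^bold>\<not> B \<Longrightarrow> \<Gamma> \<turnstile>\<^sub>I\<^sub>I A \<^bold>\<or> B"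
| DisjI3: "\<Gamma> \<turnstile>\<^sub>I\<^sub>I A \<^bold>\<and> B \<Longrightarrow> \<Gamma> \<turnstile>\<^sub>I\<^sub>I A \<^bold>\<or> B"
| DisjE: "\<Gamma> \<turnstile>\<^sub>I\<^sub>I A \<^bold>\<or> B \<Longrightarrow> \<Gamma> \<union> {A \<^bold>\<and> B} \<turnstile>\<^sub>I\<^sub>I C \<Longrightarrow> \<Gamma> \<union> {A \<^bold>\<and> \<^bold>\<not> B} \<turnstile>\<^sub>I\<^sub>I C
    \<Longrightarrow> \<Gamma> \<union> {\<^bold>\<not> A \<^bold>\<and> B} \<turnstile>\<^sub>I\<^sub>I C \<Longrightarrow> \<Gamma> \<turnstile>\<^sub>I\<^sub>I C"
| ConjI: "\<Gamma> \<turnstile>\<^sub>I\<^sub>I A \<Longrightarrow> \<Gamma> \<turnstile>\<^sub>I\<^sub>I B \<Longrightarrow> \<Gamma> \<turnstile>\<^sub>I\<^sub>I A \<^bold>\<and> B"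
| ConjE1: "\<Gamma> \<turnstile>\<^sub>I\<^sub>I A \<^bold>\<and> B \<Longrightarrow> \<Gamma> \<turnstile>\<^sub>I\<^sub>I A"
| ConjE2: "\<Gamma> \<turnstile>\<^sub>I\<^sub>I A \<^bold>\<and> B \<Longrightarrow> \<Gamma> \<turnstile>\<^sub>I\<^sub>I B"
| BoxI1: "\<Gamma> \<turnstile>\<^sub>I\<^sub>I A \<Longrightarrow> {A \<^bold>\<or> \<^bold>\<not> A} \<union> {\<^bold>\<box> B | B. B \<in> \<Gamma>} \<turnstile>\<^sub>I\<^sub>I \<^bold>\<box> A"
| BoxI2: "\<Gamma> \<turnstile>\<^sub>I\<^sub>I A \<^bold>\<or> \<^bold>\<not> A \<Longrightarrow> \<Gamma> \<turnstile>\<^sub>I\<^sub>I \<^bold>\<box> (A \<^bold>\<or> \<^bold>\<not> A)"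
| NegDisjI: "\<Gamma> \<turnstile>\<^sub>I\<^sub>I \<^bold>\<not> A \<^bold>\<and> \<^bold>\<not> B \<Longrightarrow> \<Gamma> \<turnstile>\<^sub>I\<^sub>I \<^bold>\<not> (A \<^bold>\<or> B)"
| NegDisjE: "\<Gamma> \<turnstile>\<^sub>I\<^sub>I \<^bold>\<not> (A \<^bold>\<or> B) \<Longrightarrow> \<Gamma> \<turnstile>\<^sub>I\<^sub>I \<^bold>\<not> A \<^bold>\<and> \<^bold>\<not> B"
| NegConjI: "\<Gamma> \<turnstile>\<^sub>I\<^sub>I \<^bold>\<not> A \<^bold>\<or> \<^bold>\<not> B \<Longrightarrow> \<Gamma> \<turnstile>\<^sub>I\<^sub>I \<^bold>\<not> (A \<^bold>\<and> B)"
| NegConjE: "\<Gamma> \<turnstile>\<^sub>I\<^sub>I \<^bold>\<not> (A \<^bold>\<and> B) \<Longrightarrow> \<Gamma> \<turnstile>\<^sub>I\<^sub>I \<^bold>\<not> A \<^bold>\<or> \<^bold>\<not> B"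
| NegBoxI: "\<Gamma> \<turnstile>\<^sub>I\<^sub>I A \<^bold>\<or> \<^bold>\<not> A \<Longrightarrow> \<Gamma> \<turnstile>\<^sub>I\<^sub>I \<^bold>\<box> A \<^bold>\<or> \<^bold>\<not> \<^bold>\<box> A"
| NegBoxE: "\<Gamma> \<turnstile>\<^sub>I\<^sub>I \<^bold>\<box> A \<^bold>\<or> \<^bold>\<not> \<^bold>\<box> A \<Longrightarrow> \<Gamma> \<turnstile>\<^sub>I\<^sub>I A \<^bold>\<or> \<^bold>\<not> A"

end

theory Submission
  imports Defs
begin

text \<open>In Semantics II a formula is undefined exactly when one of its letters is, and undefinedness of
  letters travels backwards along the accessibility relation; hence a formula that is defined at a
  world is defined at all its successors (\<open>Val_defined_successor\<close>). This is what makes the rule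
  \<open>BoxI2\<close> sound; the other rules follow from the truth tables and the clause for \<open>\<^bold>\<box>\<close>.

  Strong completeness is a canonical model argument. Derivations use finitely many assumptions
  (\<open>deriv_II_finite\<close>), so by Zorn's lemma a set not deriving \<open>A\<close> extends to a maximal such set,
  which is a prime theory (\<open>Lindenbaum\<close>). The worlds are the prime theories. Excluded middle is not
  derivable, so a prime theory need not decide every formula: \<open>w\<close> makes \<open>A\<close> true when \<open>A \<in> w\<close>,
  false when \<open>\<^bold>\<not> A \<in> w\<close>, and undefined otherwise.
  The three-case disjunction elimination gives the kind of primeness that weak Kleene
  disjunction asks for: a disjunction in \<open>w\<close> not only has a true disjunct but has both disjuncts
  decided. The formula \<open>A \<^bold>\<or> \<^bold>\<not> A\<close> thus expresses in the object language that \<open>A\<close> is defined.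

  With \<open>v\<close> accessible from \<open>w\<close> when \<open>\<^bold>\<box> B \<in> w\<close> implies \<open>B \<in> v\<close>, the rule \<open>BoxI2\<close>
  says that whatever is defined at \<open>w\<close> is defined at \<open>v\<close>, so the canonical model is a model-II. In
  the truth lemma (\<open>Val_canonical\<close>) the premise \<open>A \<^bold>\<or> \<^bold>\<not> A\<close> of \<open>BoxI1\<close> is matched by
  the clause of the semantics that makes \<open>\<^bold>\<box> A\<close> true only where \<open>A\<close> is defined.\<close>

section \<open>Soundness\<close>

lemma conj_tv_simps [simp]:
  "conj_tv x y = UU \<longleftrightarrow> x = UU \<or> y = UU"
  "conj_tv x y = TT \<longleftrightarrow> x = TT \<and> y = TT"
  by (auto simp: conj_tv_def)

lemma disj_tv_simps [simp]:
  "disj_tv x y = UU \<longleftrightarrow> x = UU \<or> y = UU"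
  "disj_tv x y = TT \<longleftrightarrow> x = TT \<and> y = TT \<or> x = TT \<and> y = FF \<or> x = FF \<and> y = TT"
  by (cases x; cases y; simp add: disj_tv_def)+

lemma neg_tv_simps [simp]:
  "neg_tv x = UU \<longleftrightarrow> x = UU"
  "neg_tv x = TT \<longleftrightarrow> x = FF"
  "neg_tv x = FF \<longleftrightarrow> x = TT"
  by (cases x; simp)+

text \<open>All connectives, the box included, yield an undefined value exactly when some argument is
  undefined at the world of evaluation, so the condition on letters spreads to all formulae.\<close>

lemma Val_defined_successor:
  assumes "kripke_model_II M" and "(s, t) \<in> acc M" and "Val M s A \<noteq> UU"
  shows "Val M t A \<noteq> UU"
  using assms(3)
proof (induction A)
  case (Atom p)
  then show ?case
    using assms(1,2) unfolding kripke_model_II_def kripke_model_def by fastforce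
qed (auto split: if_splits)

lemma soundness:
  assumes "\<Gamma> \<turnstile>\<^sub>I\<^sub>I A" and "kripke_model_II M"
    and "s \<in> worlds M" and "\<forall>B\<in>\<Gamma>. Val M s B = TT"
  shows "Val M s A = TT"
  using assms(1,3,4)
proof (induction arbitrary: s rule: deriv_II.induct)
  case (Comp \<Gamma> \<Delta> A)
  then show ?case by blast
next
  case (BoxI1 \<Gamma> A)
  have "Val M t A = TT" if "t \<in> worlds M" "(s, t) \<in> acc M" for t
  proof (rule BoxI1.IH[OF that(1)], rule ballI)
    fix B assume "B \<in> \<Gamma>"
    then have "Val M s (\<^bold>\<box> B) = TT" using BoxI1.prems by blast
    then show "Val M t B = TT" using that by (auto split: if_splits)
  qed
  moreover have "Val M s (A \<^bold>\<or> \<^bold>\<not> A) = TT" using BoxI1.prems by blast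
  ultimately show ?case by auto
next
  case (BoxI2 \<Gamma> A)
  have defined: "Val M s A \<noteq> UU" using BoxI2.IH[OF BoxI2.prems] by auto
  have "Val M t (A \<^bold>\<or> \<^bold>\<not> A) = TT" if "(s, t) \<in> acc M" for t
    using Val_defined_successor[OF assms(2) that defined] by (cases "Val M t A") auto
  then show ?case using defined by auto
next
  case (DisjE \<Gamma> A B C)
  then show ?case by auto
next
  case (NegBoxI \<Gamma> A)
  from NegBoxI.IH[OF NegBoxI.prems] show ?case by auto
next
  case (NegBoxE \<Gamma> A)
  from NegBoxE.IH[OF NegBoxE.prems] show ?case by (cases "Val M s A") auto
next
  case (NegConjI \<Gamma> A B)
  from NegConjI.IH[OF NegConjI.prems] show ?case by (auto simp: conj_tv_def)
next
  case (NegConjE \<Gamma> A B)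
  from NegConjE.IH[OF NegConjE.prems] show ?case
    by (cases "Val M s A"; cases "Val M s B") (auto simp: conj_tv_def)
next
  case (NegDisjI \<Gamma> A B)
  from NegDisjI.IH[OF NegDisjI.prems] show ?case by (auto simp: disj_tv_def)
next
  case (NegDisjE \<Gamma> A B)
  from NegDisjE.IH[OF NegDisjE.prems] show ?case
    by (cases "Val M s A"; cases "Val M s B") (auto simp: disj_tv_def)
next
  case (EFQ \<Gamma> A B)
  from EFQ.IH(1)[OF EFQ.prems] EFQ.IH(2)[OF EFQ.prems] show ?case by auto
qed auto

lemma soundness_consequence:
  assumes "\<Gamma> \<turnstile>\<^sub>I\<^sub>I A"
  shows "consequence_II W \<Gamma> A"
  unfolding consequence_II_def sat_II_def using soundness[OF assms] by metis

section \<open>Finite character of derivations\<close>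

text \<open>The composition rule has one premise for each formula of a possibly infinite set, but by
  induction only finitely many of these premises are needed.\<close>

lemma deriv_II_finite:
  assumes "\<Gamma> \<turnstile>\<^sub>I\<^sub>I A"
  shows "\<exists>F. finite F \<and> F \<subseteq> \<Gamma> \<and> F \<turnstile>\<^sub>I\<^sub>I A"
  using assms
proof (induction rule: deriv_II.induct)
  case (Assm A \<Gamma>)
  have "{A} \<turnstile>\<^sub>I\<^sub>I A" by (simp add: deriv_II.Assm)
  then show ?case using Assm by (intro exI[of _ "{A}"]) auto
next
  case (Weaken \<Gamma> A \<Delta>)
  then show ?case by blast
next
  case (Comp \<Gamma> \<Delta> A)
  obtain F where F: "finite F" "F \<subseteq> \<Gamma>" "F \<turnstile>\<^sub>I\<^sub>I A" using Comp.IH(2) by blast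
  have "\<forall>B\<in>F. \<exists>G. finite G \<and> G \<subseteq> \<Delta> \<and> G \<turnstile>\<^sub>I\<^sub>I B" using Comp.IH(1) F(2) by blast
  then obtain G where G: "\<forall>B\<in>F. finite (G B) \<and> G B \<subseteq> \<Delta> \<and> G B \<turnstile>\<^sub>I\<^sub>I B" by metis
  have "\<Union>(G ` F) \<turnstile>\<^sub>I\<^sub>I B" if "B \<in> F" for B
    by (rule deriv_II.Weaken[of "G B"]) (use G that in auto)
  then have "\<Union>(G ` F) \<turnstile>\<^sub>I\<^sub>I A" using F(3) by (rule deriv_II.Comp)
  then show ?case using F(1) G by (intro exI[of _ "\<Union>(G ` F)"]) auto
next
  case (DisjE \<Gamma> A B C)
  obtain F0 where F0: "finite F0" "F0 \<subseteq> \<Gamma>" "F0 \<turnstile>\<^sub>I\<^sub>I A \<^bold>\<or> B" using DisjE.IH(1) by blast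
  have drop: "\<exists>F. finite F \<and> F \<subseteq> \<Gamma> \<and> F \<union> {X} \<turnstile>\<^sub>I\<^sub>I C"
    if X: "\<exists>F. finite F \<and> F \<subseteq> \<Gamma> \<union> {X} \<and> F \<turnstile>\<^sub>I\<^sub>I C" for X
  proof -
    obtain F where "finite F" "F \<subseteq> \<Gamma> \<union> {X}" "F \<turnstile>\<^sub>I\<^sub>I C" using X by blast
    moreover from this have "F - {X} \<union> {X} \<turnstile>\<^sub>I\<^sub>I C" by (blast intro: deriv_II.Weaken)
    ultimately show ?thesis by (intro exI[of _ "F - {X}"]) blast
  qed
  obtain F1 where F1: "finite F1" "F1 \<subseteq> \<Gamma>" "F1 \<union> {A \<^bold>\<and> B} \<turnstile>\<^sub>I\<^sub>I C"
    using drop[OF DisjE.IH(2)] by blast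
  obtain F2 where F2: "finite F2" "F2 \<subseteq> \<Gamma>" "F2 \<union> {A \<^bold>\<and> \<^bold>\<not> B} \<turnstile>\<^sub>I\<^sub>I C"
    using drop[OF DisjE.IH(3)] by blast
  obtain F3 where F3: "finite F3" "F3 \<subseteq> \<Gamma>" "F3 \<union> {\<^bold>\<not> A \<^bold>\<and> B} \<turnstile>\<^sub>I\<^sub>I C"
    using drop[OF DisjE.IH(4)] by blast
  let ?F = "F0 \<union> F1 \<union> F2 \<union> F3"
  have "?F \<turnstile>\<^sub>I\<^sub>I C"
  proof (rule deriv_II.DisjE)
    show "?F \<turnstile>\<^sub>I\<^sub>I A \<^bold>\<or> B" using F0(3) by (rule deriv_II.Weaken) blast
    show "?F \<union> {A \<^bold>\<and> B} \<turnstile>\<^sub>I\<^sub>I C" using F1(3) by (rule deriv_II.Weaken) blast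
    show "?F \<union> {A \<^bold>\<and> \<^bold>\<not> B} \<turnstile>\<^sub>I\<^sub>I C" using F2(3) by (rule deriv_II.Weaken) blast
    show "?F \<union> {\<^bold>\<not> A \<^bold>\<and> B} \<turnstile>\<^sub>I\<^sub>I C" using F3(3) by (rule deriv_II.Weaken) blast
  qed
  then show ?case using F0 F1 F2 F3 by (intro exI[of _ ?F]) blast
next
  case (BoxI1 \<Gamma> A)
  then obtain F where F: "finite F" "F \<subseteq> \<Gamma>" "F \<turnstile>\<^sub>I\<^sub>I A" by blast
  then show ?case
    using deriv_II.BoxI1[OF F(3)]
    by (intro exI[of _ "{A \<^bold>\<or> \<^bold>\<not> A} \<union> {\<^bold>\<box> B |B. B \<in> F}"]) auto
next
  case (EFQ \<Gamma> A B)
  then obtain F G where FG: "finite F" "F \<subseteq> \<Gamma>" "F \<turnstile>\<^sub>I\<^sub>I A" "finite G" "G \<subseteq> \<Gamma>" "G \<turnstile>\<^sub>I\<^sub>I \<^bold>\<not> A"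
    by blast
  have "F \<union> G \<turnstile>\<^sub>I\<^sub>I B"
    by (rule deriv_II.EFQ; rule deriv_II.Weaken[OF FG(3)] deriv_II.Weaken[OF FG(6)]) auto
  then show ?case using FG by (intro exI[of _ "F \<union> G"]) blast
next
  case (ConjI \<Gamma> A B)
  then obtain F G where FG: "finite F" "F \<subseteq> \<Gamma>" "F \<turnstile>\<^sub>I\<^sub>I A" "finite G" "G \<subseteq> \<Gamma>" "G \<turnstile>\<^sub>I\<^sub>I B"
    by blast
  have "F \<union> G \<turnstile>\<^sub>I\<^sub>I A \<^bold>\<and> B"
    by (rule deriv_II.ConjI; rule deriv_II.Weaken[OF FG(3)] deriv_II.Weaken[OF FG(6)]) auto
  then show ?case using FG by (intro exI[of _ "F \<union> G"]) blast
qed (elim exE conjE, intro exI conjI, assumption, assumption,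
     rule deriv_II.NegNegI deriv_II.NegNegE deriv_II.DisjI1 deriv_II.DisjI2 deriv_II.DisjI3
       deriv_II.ConjE1 deriv_II.ConjE2 deriv_II.BoxI2 deriv_II.NegDisjI deriv_II.NegDisjE
       deriv_II.NegConjI deriv_II.NegConjE deriv_II.NegBoxI deriv_II.NegBoxE,
     assumption)+

section \<open>Prime theories\<close>

text \<open>The primeness clause mirrors the three rows of the weak Kleene table in which a disjunction is
  true; in particular both disjuncts are decided.\<close>

definition prime_theory :: "'p fm set \<Rightarrow> bool" where
  "prime_theory w \<longleftrightarrow> (\<forall>A. w \<turnstile>\<^sub>I\<^sub>I A \<longrightarrow> A \<in> w) \<and> w \<noteq> UNIV \<and>
     (\<forall>A B. A \<^bold>\<or> B \<in> w \<longrightarrow> A \<^bold>\<and> B \<in> w \<or> A \<^bold>\<and> \<^bold>\<not> B \<in> w \<or> \<^bold>\<not> A \<^bold>\<and> B \<in> w)"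

text \<open>A maximal set among those not deriving \<open>A\<close> is prime: if it contained none of the three
  cases of a disjunction, adding any of them would make \<open>A\<close> derivable, and so would
  the disjunction by case distinction.\<close>

lemma Lindenbaum:
  assumes "\<not> \<Gamma> \<turnstile>\<^sub>I\<^sub>I A"
  obtains w where "\<Gamma> \<subseteq> w" "prime_theory w" "A \<notin> w"
proof -
  let ?\<A> = "{\<Delta>. \<Gamma> \<subseteq> \<Delta> \<and> \<not> \<Delta> \<turnstile>\<^sub>I\<^sub>I A}"
  have "\<exists>w\<in>?\<A>. \<forall>X\<in>?\<A>. w \<subseteq> X \<longrightarrow> X = w"
  proof (rule subset_Zorn_nonempty)
    show "?\<A> \<noteq> {}" using assms by blast
    fix \<C> assume \<C>: "\<C> \<noteq> {}" "subset.chain ?\<A> \<C>"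
    have "\<not> \<Union>\<C> \<turnstile>\<^sub>I\<^sub>I A"
    proof
      assume "\<Union>\<C> \<turnstile>\<^sub>I\<^sub>I A"
      then obtain F where F: "finite F" "F \<subseteq> \<Union>\<C>" "F \<turnstile>\<^sub>I\<^sub>I A" using deriv_II_finite by blast
      then obtain \<Delta> where "\<Delta> \<in> \<C>" "F \<subseteq> \<Delta>"
        using finite_subset_Union_chain[OF F(1,2) \<C>] by blast
      with F(3) have "\<Delta> \<in> \<C>" "\<Delta> \<turnstile>\<^sub>I\<^sub>I A" using deriv_II.Weaken by blast+
      with \<C>(2) show False by (auto simp: subset.chain_def)
    qed
    moreover have "\<Gamma> \<subseteq> \<Union>\<C>" using \<C> unfolding subset.chain_def by blast
    ultimately show "\<Union>\<C> \<in> ?\<A>" by blast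
  qed
  then obtain w where "w \<in> ?\<A>" and max: "\<forall>X\<in>?\<A>. w \<subseteq> X \<longrightarrow> X = w" by (rule bexE)
  then have w: "\<Gamma> \<subseteq> w" "\<not> w \<turnstile>\<^sub>I\<^sub>I A" by simp_all
  have extend: "w \<union> {B} \<turnstile>\<^sub>I\<^sub>I A" if "B \<notin> w" for B
  proof (rule ccontr)
    assume "\<not> w \<union> {B} \<turnstile>\<^sub>I\<^sub>I A"
    then have "w \<union> {B} = w" using max w(1) by blast
    then show False using that by blast
  qed
  have "prime_theory w"
    unfolding prime_theory_def
  proof (intro conjI allI impI)
    fix B assume B: "w \<turnstile>\<^sub>I\<^sub>I B"
    show "B \<in> w"
    proof (rule ccontr)
      assume "B \<notin> w"
      then have "w \<union> {B} \<turnstile>\<^sub>I\<^sub>I A" by (rule extend)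
      moreover have "\<And>C. C \<in> w \<union> {B} \<Longrightarrow> w \<turnstile>\<^sub>I\<^sub>I C" using B deriv_II.Assm by blast
      ultimately show False using w(2) deriv_II.Comp by blast
    qed
  next
    show "w \<noteq> UNIV" using w(2) deriv_II.Assm by blast
  next
    fix B C assume "B \<^bold>\<or> C \<in> w"
    then show "B \<^bold>\<and> C \<in> w \<or> B \<^bold>\<and> \<^bold>\<not> C \<in> w \<or> \<^bold>\<not> B \<^bold>\<and> C \<in> w"
      using extend w(2) deriv_II.DisjE[OF deriv_II.Assm] by blast
  qed
  moreover have "A \<notin> w" using w(2) deriv_II.Assm by blast
  ultimately show thesis using that w(1) by blast
qed

lemma prime_theory_closed: "prime_theory w \<Longrightarrow> w \<turnstile>\<^sub>I\<^sub>I A \<Longrightarrow> A \<in> w"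
  by (simp add: prime_theory_def)

lemma prime_theory_consistent:
  assumes "prime_theory w" and "A \<in> w"
  shows "\<^bold>\<not> A \<notin> w"
proof
  assume "\<^bold>\<not> A \<in> w"
  then have "w = UNIV"
    using assms deriv_II.EFQ[OF deriv_II.Assm deriv_II.Assm, of A w] prime_theory_closed by blast
  then show False using assms(1) by (simp add: prime_theory_def)
qed

lemma prime_theory_NegNeg: "prime_theory w \<Longrightarrow> \<^bold>\<not> \<^bold>\<not> A \<in> w \<longleftrightarrow> A \<in> w"
  by (metis deriv_II.Assm deriv_II.NegNegE deriv_II.NegNegI prime_theory_closed)

lemma prime_theory_Conj: "prime_theory w \<Longrightarrow> A \<^bold>\<and> B \<in> w \<longleftrightarrow> A \<in> w \<and> B \<in> w"
  by (metis deriv_II.Assm deriv_II.ConjE1 deriv_II.ConjE2 deriv_II.ConjI prime_theory_closed)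

lemma prime_theory_Disj:
  assumes "prime_theory w"
  shows "A \<^bold>\<or> B \<in> w \<longleftrightarrow> A \<in> w \<and> B \<in> w \<or> A \<in> w \<and> \<^bold>\<not> B \<in> w \<or> \<^bold>\<not> A \<in> w \<and> B \<in> w"
proof -
  have "A \<^bold>\<or> B \<in> w \<longleftrightarrow> A \<^bold>\<and> B \<in> w \<or> A \<^bold>\<and> \<^bold>\<not> B \<in> w \<or> \<^bold>\<not> A \<^bold>\<and> B \<in> w"
    using assms unfolding prime_theory_def
    by (meson deriv_II.Assm deriv_II.DisjI1 deriv_II.DisjI2 deriv_II.DisjI3)
  then show ?thesis by (simp add: prime_theory_Conj[OF assms])
qed

lemma prime_theory_NegDisj: "prime_theory w \<Longrightarrow> \<^bold>\<not> (A \<^bold>\<or> B) \<in> w \<longleftrightarrow> \<^bold>\<not> A \<in> w \<and> \<^bold>\<not> B \<in> w"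
  by (metis deriv_II.Assm deriv_II.NegDisjI deriv_II.NegDisjE prime_theory_closed prime_theory_Conj)

lemma prime_theory_NegConj: "prime_theory w \<Longrightarrow> \<^bold>\<not> (A \<^bold>\<and> B) \<in> w \<longleftrightarrow> \<^bold>\<not> A \<^bold>\<or> \<^bold>\<not> B \<in> w"
  by (metis deriv_II.Assm deriv_II.NegConjI deriv_II.NegConjE prime_theory_closed)

lemma prime_theory_excluded_middle:
  "prime_theory w \<Longrightarrow> A \<^bold>\<or> \<^bold>\<not> A \<in> w \<longleftrightarrow> A \<in> w \<or> \<^bold>\<not> A \<in> w"
  by (auto simp: prime_theory_Disj prime_theory_NegNeg)

lemma prime_theory_Box_decided:
  "prime_theory w \<Longrightarrow> \<^bold>\<box> A \<in> w \<or> \<^bold>\<not> \<^bold>\<box> A \<in> w \<longleftrightarrow> A \<in> w \<or> \<^bold>\<not> A \<in> w"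
  by (metis deriv_II.Assm deriv_II.NegBoxI deriv_II.NegBoxE prime_theory_closed
      prime_theory_excluded_middle)

section \<open>The canonical model\<close>

definition membership_value :: "'p fm set \<Rightarrow> 'p fm \<Rightarrow> tv" where
  "membership_value w A = (if A \<in> w then TT else if \<^bold>\<not> A \<in> w then FF else UU)"

definition canonical :: "('p fm set, 'p) kripke" where
  "canonical = \<lparr>worlds = {w. prime_theory w},
     acc = {(w, v). prime_theory w \<and> prime_theory v \<and> (\<forall>B. \<^bold>\<box> B \<in> w \<longrightarrow> B \<in> v)},
     valuation = (\<lambda>w p. membership_value w (Atom p))\<rparr>"

lemma worlds_canonical: "w \<in> worlds canonical \<longleftrightarrow> prime_theory w"
  by (simp add: canonical_def)

lemma acc_canonical:
  "(w, v) \<in> acc canonical \<longleftrightarrow>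
     prime_theory w \<and> prime_theory v \<and> (\<forall>B. \<^bold>\<box> B \<in> w \<longrightarrow> B \<in> v)"
  by (simp add: canonical_def)

text \<open>The syntactic counterpart of \<open>Val_defined_successor\<close>: if \<open>A\<close> is decided at \<open>w\<close>, then
  \<open>A \<^bold>\<or> \<^bold>\<not> A\<close> and, by \<open>BoxI2\<close>, its necessitation belong to \<open>w\<close>.\<close>

lemma decided_successor:
  assumes "(w, v) \<in> acc canonical" and "A \<in> w \<or> \<^bold>\<not> A \<in> w"
  shows "A \<in> v \<or> \<^bold>\<not> A \<in> v"
proof -
  have w: "prime_theory w" and v: "prime_theory v" using assms(1) by (auto simp: acc_canonical)
  have "A \<^bold>\<or> \<^bold>\<not> A \<in> w" using assms(2) by (simp add: prime_theory_excluded_middle[OF w])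
  then have "\<^bold>\<box> (A \<^bold>\<or> \<^bold>\<not> A) \<in> w"
    by (rule prime_theory_closed[OF w, OF deriv_II.BoxI2, OF deriv_II.Assm])
  then have "A \<^bold>\<or> \<^bold>\<not> A \<in> v" using assms(1) by (simp add: acc_canonical)
  then show ?thesis by (simp add: prime_theory_excluded_middle[OF v])
qed

lemma kripke_model_II_canonical:
  assumes "prime_theory (w :: 'p fm set)"
  shows "kripke_model_II (canonical :: ('p fm set, 'p) kripke)"
  unfolding kripke_model_II_def kripke_model_def
proof (intro conjI ballI allI impI)
  show "worlds (canonical :: ('p fm set, 'p) kripke) \<noteq> {}"
    using assms by (auto simp: canonical_def)
  show "acc (canonical :: ('p fm set, 'p) kripke) \<subseteq> worlds canonical \<times> worlds canonical"
    by (auto simp: canonical_def)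
next
  fix s t :: "'p fm set" and p
  assume "valuation canonical s p = UU" and "(t, s) \<in> acc canonical"
  then show "valuation canonical t p = UU"
    using decided_successor[of t s "Atom p"]
    by (auto simp: canonical_def membership_value_def split: if_splits)
qed

text \<open>The box is where new worlds must be found. When \<open>A\<close> is decided at \<open>w\<close> but \<open>\<^bold>\<box> A \<notin> w\<close>, the
  formulae necessary at \<open>w\<close> do not derive \<open>A\<close>, as otherwise \<open>BoxI1\<close> would yield \<open>\<^bold>\<box> A \<in> w\<close>.\<close>

lemma Box_in_prime_theory:
  assumes w: "prime_theory w"
  shows "\<^bold>\<box> A \<in> w \<longleftrightarrow>
    (A \<in> w \<or> \<^bold>\<not> A \<in> w) \<and> (\<forall>v. (w, v) \<in> acc canonical \<longrightarrow> A \<in> v)"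
proof
  assume "\<^bold>\<box> A \<in> w"
  then show "(A \<in> w \<or> \<^bold>\<not> A \<in> w) \<and> (\<forall>v. (w, v) \<in> acc canonical \<longrightarrow> A \<in> v)"
    using prime_theory_Box_decided[OF w] by (auto simp: acc_canonical)
next
  assume *: "(A \<in> w \<or> \<^bold>\<not> A \<in> w) \<and> (\<forall>v. (w, v) \<in> acc canonical \<longrightarrow> A \<in> v)"
  have "{B. \<^bold>\<box> B \<in> w} \<turnstile>\<^sub>I\<^sub>I A"
  proof (rule ccontr)
    assume "\<not> {B. \<^bold>\<box> B \<in> w} \<turnstile>\<^sub>I\<^sub>I A"
    then obtain v where "{B. \<^bold>\<box> B \<in> w} \<subseteq> v" "prime_theory v" "A \<notin> v" by (rule Lindenbaum)
    then show False using * w by (auto simp: acc_canonical)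
  qed
  then have "{A \<^bold>\<or> \<^bold>\<not> A} \<union> {\<^bold>\<box> B |B. B \<in> {B. \<^bold>\<box> B \<in> w}} \<turnstile>\<^sub>I\<^sub>I \<^bold>\<box> A"
    by (rule deriv_II.BoxI1)
  moreover have "A \<^bold>\<or> \<^bold>\<not> A \<in> w" using * by (simp add: prime_theory_excluded_middle[OF w])
  ultimately have "w \<turnstile>\<^sub>I\<^sub>I \<^bold>\<box> A" by (elim deriv_II.Weaken) auto
  then show "\<^bold>\<box> A \<in> w" by (rule prime_theory_closed[OF w])
qed

text \<open>Primeness puts \<open>\<^bold>\<not> A \<^bold>\<or> \<^bold>\<not> B\<close>, hence \<open>\<^bold>\<not> (A \<^bold>\<and> B)\<close>, in \<open>w\<close> only when \<open>A\<close> and \<open>B\<close> are both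
  decided, which is how the infectious third value comes out right for conjunction. For the box, the
  rules \<open>NegBoxI\<close> and \<open>NegBoxE\<close> ensure that \<open>\<^bold>\<box> A\<close> is decided exactly where \<open>A\<close> is.\<close>

lemma Val_canonical:
  assumes "prime_theory w"
  shows "Val canonical w A = membership_value w A"
  using assms
proof (induction A arbitrary: w)
  case (Atom p)
  then show ?case by (simp add: canonical_def)
next
  case (Neg A)
  then show ?case
    using prime_theory_consistent[OF Neg.prems, of A]
    by (auto simp: membership_value_def prime_theory_NegNeg)
next
  case (Conj A B)
  then show ?case
    using prime_theory_consistent[OF Conj.prems, of A] prime_theory_consistent[OF Conj.prems, of B]
    by (auto simp: membership_value_def conj_tv_def prime_theory_NegConj prime_theory_Conj
        prime_theory_Disj prime_theory_NegNeg)
next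
  case (Disj A B)
  then show ?case
    using prime_theory_consistent[OF Disj.prems, of A] prime_theory_consistent[OF Disj.prems, of B]
    by (auto simp: membership_value_def disj_tv_def prime_theory_NegDisj prime_theory_Disj)
next
  case (Box A)
  note w = Box.prems
  have val_w: "Val canonical w A \<noteq> UU \<longleftrightarrow> A \<in> w \<or> \<^bold>\<not> A \<in> w"
    by (simp add: Box.IH[OF w] membership_value_def)
  have "v \<in> worlds canonical" and "Val canonical v A = TT \<longleftrightarrow> A \<in> v"
    if "(w, v) \<in> acc canonical" for v
  proof -
    have v: "prime_theory v" using that unfolding acc_canonical by (elim conjE)
    show "v \<in> worlds canonical" using v by (simp only: worlds_canonical)
    show "Val canonical v A = TT \<longleftrightarrow> A \<in> v" by (simp add: Box.IH[OF v] membership_value_def)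
  qed
  then have val_v: "(\<forall>v\<in>worlds canonical. (w, v) \<in> acc canonical \<longrightarrow> Val canonical v A = TT) \<longleftrightarrow>
      (\<forall>v. (w, v) \<in> acc canonical \<longrightarrow> A \<in> v)"
    by blast
  have "Val canonical w (\<^bold>\<box> A) = (if \<^bold>\<box> A \<in> w then TT
      else if \<not> (A \<in> w \<or> \<^bold>\<not> A \<in> w) then UU else FF)"
    unfolding Box_in_prime_theory[OF w] val_w[symmetric] val_v[symmetric] Val.simps not_not
    by (rule refl)
  then show ?case
    unfolding membership_value_def prime_theory_Box_decided[OF w, of A, symmetric] by simp
qed

section \<open>Soundness and strong completeness\<close>

lemma completeness:
  fixes \<Gamma> :: "'p fm set"
  assumes "consequence_II TYPE('p fm set) \<Gamma> A"
  shows "\<Gamma> \<turnstile>\<^sub>I\<^sub>I A"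
proof (rule ccontr)
  assume "\<not> \<Gamma> \<turnstile>\<^sub>I\<^sub>I A"
  then obtain w where w: "\<Gamma> \<subseteq> w" "prime_theory w" "A \<notin> w" by (rule Lindenbaum)
  have "Val canonical w B = TT \<longleftrightarrow> B \<in> w" for B
    by (simp add: Val_canonical[OF w(2)] membership_value_def)
  then show False
    using assms w kripke_model_II_canonical[OF w(2)]
    unfolding consequence_II_def sat_II_def worlds_canonical[symmetric] by blast
qed

theorem theorem6:
  fixes \<Gamma> :: "'p::countable fm set" and A :: "'p fm"
  shows "(\<Gamma> \<turnstile>\<^sub>I\<^sub>I A \<longleftrightarrow> consequence_II TYPE('p fm set) \<Gamma> A) \<and>
         (\<Gamma> \<turnstile>\<^sub>I\<^sub>I A \<longrightarrow> consequence_II TYPE('w) \<Gamma> A)"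
proof (intro conjI iffI impI)
  assume "\<Gamma> \<turnstile>\<^sub>I\<^sub>I A"
  then show "consequence_II TYPE('p fm set) \<Gamma> A" and "consequence_II TYPE('w) \<Gamma> A"
    by (rule soundness_consequence)+
next
  assume "consequence_II TYPE('p fm set) \<Gamma> A"
  then show "\<Gamma> \<turnstile>\<^sub>I\<^sub>I A" by (rule completeness)
qed

end
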